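(* Let $\mathcal{H}=\sum_{r=1}^m c_r p_r$ be an $n$-qubit Hamiltonian, where $p_1,\dots,p_m\in\{I,X,Y,Z\}^{\otimes n}$ are pairwise distinct Pauli strings and $c_r\in\mathbb{C}\setminus\{0\}$. Let $G_{\mathcal{H}}\le S_n$ be its permutation symmetry group and let $\mathcal{G}$ be the coloured bipartite graph constructed from $\mathcal{H}$. Then the permutation symmetry group of $\mathcal{H}$ is isomorphic, as a group, to the automorphism group of $\mathcal{G}$: $$G_{\mathcal{H}}\cong \mathrm{aut}(\mathcal{G}).$$
   Context: Pauli strings and permutations: a Pauli string on $n$ qubits is a tensor product $p=\bigotimes_{i=1}^n [p]_i$ with $[p]_i\in\{I,X,Y,Z\}$ (the identity and the three Pauli matrices); $[p]_i$ is the operator of $p$ at qubit $i$. A permutation $\varsigma\in S_n$ acts on Pauli strings by moving the operator at qubit $i$ to qubit $\varsigma(i)$, i.e. $[\varsigma(p)]_{\varsigma(i)}=[p]_i$ for all $i$. The Hamiltonian $\mathcal{H}=\sum_{r=1}^m c_rp_r$ is represented by the finite set $T=\{(c_r,p_r): r=1,\dots,m\}$, with at most one pair $(c,p)$ for each Pauli string $p$. One sets $\varsigma(\mathcal{H})=\sum_r c_r\,\varsigma(p_r)$ and $\varsigma(T)=\{(c_r,\varsigma(p_r)) : r=1,\dots,m\}$. Permutation symmetry group: $G_{\mathcal{H}}=\{\varsigma\in S_n : \varsigma(\mathcal{H})=\mathcal{H}\}$, equivalently $\{\varsigma\in S_n:\varsigma(T)=T\}$. Graph of $\mathcal{H}$: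 the vertex- and edge-coloured bipartite graph $\mathcal{G}=(V,E,C_V,C_E)$ where - $V=V_Q\cup V_T$ (disjoint), with qubit nodes $V_Q=\{q_1,\dots,q_n\}$ and term nodes $V_T=\{t_1,\dots,t_m\}$, where $t_r$ corresponds to $(c_r,p_r)$; - there is an edge $(q_i,t_r)$ if and only if $[p_r]_i\neq I$, and there are no other edges; - vertex colours: $C_V(q_i)=\text{``qubit''}$ for all $i$, and $C_V(t_r)=(\text{``term''},c_r)$ for all $r$ (the colour ``qubit'' is different from every term colour); - edge colours: $C_E((q_i,t_r))=[p_r]_i\in\{X,Y,Z\}$. An automorphism of $\mathcal{G}$ is a bijection $\phi:V\to V$ such that $(u,v)\in E\iff(\phi(u),\phi(v))\in E$, $C_V(\phi(v))=C_V(v)$ for all $v\in V$, and $C_E((\phi(u),\phi(v)))=C_E((u,v))$ for all $(u,v)\in E$. The automorphisms form the group $\mathrm{aut}(\mathcal{G})$ under composition. *)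

theory Defs
  imports
    Complex_Main
    "HOL-Library.FuncSet"
    "HOL-Algebra.Bij"
    "HOL-Algebra.Sym_Groups"
    "Jordan_Normal_Form.Matrix"
begin

section \<open>Pauli strings\<close>

datatype pauli = PI | PX | PY | PZ

fun pauli_mat :: "pauli \<Rightarrow> complex mat" where
  "pauli_mat PI = mat_of_rows_list 2 [[1, 0], [0, 1]]"
| "pauli_mat PX = mat_of_rows_list 2 [[0, 1], [1, 0]]"
| "pauli_mat PY = mat_of_rows_list 2 [[0, - \<i>], [\<i>, 0]]"
| "pauli_mat PZ = mat_of_rows_list 2 [[1, 0], [0, - 1]]"

text \<open>Qubits are numbered from 1 to \<open>n\<close>. Strings are extensional functions, so that two
  strings are equal iff they agree at every qubit.\<close>

definition pauli_strings :: "nat \<Rightarrow> (nat \<Rightarrow> pauli) set" where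
  "pauli_strings n = {1..n} \<rightarrow>\<^sub>E UNIV"

definition tensor_mat :: "complex mat \<Rightarrow> complex mat \<Rightarrow> complex mat" where
  "tensor_mat A B = mat (dim_row A * dim_row B) (dim_col A * dim_col B)
     (\<lambda>(i, j). A $$ (i div dim_row B, j div dim_col B) * B $$ (i mod dim_row B, j mod dim_col B))"

primrec pauli_op :: "nat \<Rightarrow> (nat \<Rightarrow> pauli) \<Rightarrow> complex mat" where
  "pauli_op 0 p = 1\<^sub>m 1"
| "pauli_op (Suc n) p = tensor_mat (pauli_op n p) (pauli_mat (p (Suc n)))"

definition perm_string :: "nat \<Rightarrow> (nat \<Rightarrow> nat) \<Rightarrow> (nat \<Rightarrow> pauli) \<Rightarrow> nat \<Rightarrow> pauli" where
  "perm_string n \<sigma> p = (\<lambda>j\<in>{1..n}. p (inv' \<sigma> j))"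

lemma perm_string_apply:
  assumes "\<sigma> permutes {1..n}" "i \<in> {1..n}"
  shows "perm_string n \<sigma> p (\<sigma> i) = p i"
  using assms by (simp add: perm_string_def permutes_in_image permutes_inverses del: atLeastAtMost_iff)


section \<open>Hamiltonians and their permutation symmetry group\<close>

text \<open>The type \<open>complex mat\<close> carries no dimension and hence has no big sum; the linear
  combination of the \<open>2^n \<times> 2^n\<close> matrices is formed entrywise.\<close>

definition hamiltonian :: "nat \<Rightarrow> nat \<Rightarrow> (nat \<Rightarrow> complex) \<Rightarrow> (nat \<Rightarrow> nat \<Rightarrow> pauli) \<Rightarrow> complex mat" where
  "hamiltonian n m c p = mat (2 ^ n) (2 ^ n) (\<lambda>ij. \<Sum>r = 1..m. c r * pauli_op n (p r) $$ ij)"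

definition perm_symmetries ::
    "nat \<Rightarrow> nat \<Rightarrow> (nat \<Rightarrow> complex) \<Rightarrow> (nat \<Rightarrow> nat \<Rightarrow> pauli) \<Rightarrow> (nat \<Rightarrow> nat) set" where
  "perm_symmetries n m c p = {\<sigma>. \<sigma> permutes {1..n} \<and>
     hamiltonian n m c (\<lambda>r. perm_string n \<sigma> (p r)) = hamiltonian n m c p}"

definition perm_symmetry_group ::
    "nat \<Rightarrow> nat \<Rightarrow> (nat \<Rightarrow> complex) \<Rightarrow> (nat \<Rightarrow> nat \<Rightarrow> pauli) \<Rightarrow> (nat \<Rightarrow> nat) monoid" where
  "perm_symmetry_group n m c p = (sym_group n)\<lparr>carrier := perm_symmetries n m c p\<rparr>"


section \<open>Coloured graphs and their automorphism group\<close>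

text \<open>The graphs are undirected: an edge between \<open>u\<close> and \<open>v\<close> is represented by both pairs
  \<open>(u, v)\<close> and \<open>(v, u)\<close>, carrying the same colour. Colours of non-vertices and
  non-edges are irrelevant.\<close>

record ('v, 'c, 'd) coloured_graph =
  verts :: "'v set"
  edges :: "('v \<times> 'v) set"
  vcolour :: "'v \<Rightarrow> 'c"
  ecolour :: "'v \<times> 'v \<Rightarrow> 'd"

definition graph_auts :: "('v, 'c, 'd) coloured_graph \<Rightarrow> ('v \<Rightarrow> 'v) set" where
  "graph_auts G = {\<phi> \<in> Bij (verts G).
     (\<forall>u\<in>verts G. \<forall>v\<in>verts G. (u, v) \<in> edges G \<longleftrightarrow> (\<phi> u, \<phi> v) \<in> edges G) \<and>
     (\<forall>v\<in>verts G. vcolour G (\<phi> v) = vcolour G v) \<and>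
     (\<forall>(u, v)\<in>edges G. ecolour G (\<phi> u, \<phi> v) = ecolour G (u, v))}"

definition graph_aut_group :: "('v, 'c, 'd) coloured_graph \<Rightarrow> ('v \<Rightarrow> 'v) monoid" where
  "graph_aut_group G = (BijGroup (verts G))\<lparr>carrier := graph_auts G\<rparr>"


section \<open>The graph of a Hamiltonian\<close>

datatype node = Qubit nat | Term nat

datatype node_colour = Qubit_Colour | Term_Colour complex

definition hamiltonian_edges :: "nat \<Rightarrow> nat \<Rightarrow> (nat \<Rightarrow> nat \<Rightarrow> pauli) \<Rightarrow> (node \<times> node) set" where
  "hamiltonian_edges n m p =
     (let E = {(Qubit i, Term r) | i r. i \<in> {1..n} \<and> r \<in> {1..m} \<and> p r i \<noteq> PI} in E \<union> E\<inverse>)"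

fun node_colour_of :: "(nat \<Rightarrow> complex) \<Rightarrow> node \<Rightarrow> node_colour" where
  "node_colour_of c (Qubit i) = Qubit_Colour"
| "node_colour_of c (Term r) = Term_Colour (c r)"

fun edge_colour_of :: "(nat \<Rightarrow> nat \<Rightarrow> pauli) \<Rightarrow> node \<times> node \<Rightarrow> pauli" where
  "edge_colour_of p (Qubit i, Term r) = p r i"
| "edge_colour_of p (Term r, Qubit i) = p r i"
| "edge_colour_of p _ = undefined"

definition hamiltonian_graph ::
    "nat \<Rightarrow> nat \<Rightarrow> (nat \<Rightarrow> complex) \<Rightarrow> (nat \<Rightarrow> nat \<Rightarrow> pauli) \<Rightarrow> (node, node_colour, pauli) coloured_graph" where
  "hamiltonian_graph n m c p =
     \<lparr>verts = Qubit ` {1..n} \<union> Term ` {1..m},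
      edges = hamiltonian_edges n m p,
      vcolour = node_colour_of c,
      ecolour = edge_colour_of p\<rparr>"


section \<open>The two structures are groups\<close>

lemma graph_auts_subgroup:
  assumes E: "edges G \<subseteq> verts G \<times> verts G"
  shows "subgroup (graph_auts G) (BijGroup (verts G))"
proof -
  interpret B: group "BijGroup (verts G)" by (rule group_BijGroup)
  have mem: "\<phi> v \<in> verts G" if "\<phi> \<in> Bij (verts G)" "v \<in> verts G" for \<phi> v
    using Bij_imp_funcset[OF that(1)] that(2) by auto
  show ?thesis
  proof (rule B.subgroupI)
    show "graph_auts G \<subseteq> carrier (BijGroup (verts G))"
      by (auto simp: graph_auts_def BijGroup_def)
    have "(\<lambda>v\<in>verts G. v) \<in> graph_auts G"
      using E by (auto simp: graph_auts_def id_Bij)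
    then show "graph_auts G \<noteq> {}" by blast
  next
    fix \<phi> assume \<phi>: "\<phi> \<in> graph_auts G"
    then have B: "\<phi> \<in> Bij (verts G)" by (simp add: graph_auts_def)
    let ?\<psi> = "\<lambda>v\<in>verts G. inv_into (verts G) \<phi> v"
    have i: "inv_into (verts G) \<phi> v \<in> verts G" "\<phi> (inv_into (verts G) \<phi> v) = v" if "v \<in> verts G" for v
      using B that by (auto simp: Bij_def bij_betw_def intro: inv_into_into f_inv_into_f)
    have e: "(inv_into (verts G) \<phi> u, inv_into (verts G) \<phi> v) \<in> edges G \<longleftrightarrow> (u, v) \<in> edges G"
      if "u \<in> verts G" "v \<in> verts G" for u v
      using \<phi> i[OF that(1)] i[OF that(2)] by (simp add: graph_auts_def)
    have c: "vcolour G (inv_into (verts G) \<phi> v) = vcolour G v" if "v \<in> verts G" for v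
      using \<phi> i[OF that] by (auto simp: graph_auts_def dest: bspec[of _ _ "inv_into (verts G) \<phi> v"])
    have d: "ecolour G (inv_into (verts G) \<phi> u, inv_into (verts G) \<phi> v) = ecolour G (u, v)"
      if uv: "(u, v) \<in> edges G" for u v
    proof -
      have V: "u \<in> verts G" "v \<in> verts G" using E uv by auto
      have "(inv_into (verts G) \<phi> u, inv_into (verts G) \<phi> v) \<in> edges G"
        using e[OF V] uv by simp
      then have "ecolour G (\<phi> (inv_into (verts G) \<phi> u), \<phi> (inv_into (verts G) \<phi> v))
          = ecolour G (inv_into (verts G) \<phi> u, inv_into (verts G) \<phi> v)"
        using \<phi> by (auto simp: graph_auts_def)
      then show ?thesis using i V by simp
    qed
    have "?\<psi> \<in> graph_auts G"
      using restrict_inv_into_Bij[OF B] E e c d by (auto simp: graph_auts_def)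
    moreover have "inv\<^bsub>BijGroup (verts G)\<^esub> \<phi> = ?\<psi>"
      by (rule inv_BijGroup[OF B])
    ultimately show "inv\<^bsub>BijGroup (verts G)\<^esub> \<phi> \<in> graph_auts G" by simp
  next
    fix \<phi> \<psi> assume \<phi>: "\<phi> \<in> graph_auts G" and \<psi>: "\<psi> \<in> graph_auts G"
    then have B: "\<phi> \<in> Bij (verts G)" "\<psi> \<in> Bij (verts G)" by (auto simp: graph_auts_def)
    have v: "vcolour G (\<phi> (\<psi> v)) = vcolour G v" if "v \<in> verts G" for v
      using \<phi> \<psi> mem[OF B(2) that] that by (simp add: graph_auts_def)
    have e: "(\<phi> (\<psi> u), \<phi> (\<psi> v)) \<in> edges G \<longleftrightarrow> (u, v) \<in> edges G"
      if "u \<in> verts G" "v \<in> verts G" for u v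
      using \<phi> \<psi> mem[OF B(2)] that by (simp add: graph_auts_def)
    have c: "ecolour G (\<phi> (\<psi> u), \<phi> (\<psi> v)) = ecolour G (u, v)" if uv: "(u, v) \<in> edges G" for u v
    proof -
      have "(\<psi> u, \<psi> v) \<in> edges G" using \<psi> E uv by (auto simp: graph_auts_def)
      then have "ecolour G (\<phi> (\<psi> u), \<phi> (\<psi> v)) = ecolour G (\<psi> u, \<psi> v)"
        using \<phi> by (auto simp: graph_auts_def)
      also have "\<dots> = ecolour G (u, v)" using \<psi> uv by (auto simp: graph_auts_def)
      finally show ?thesis .
    qed
    have "compose (verts G) \<phi> \<psi> \<in> graph_auts G"
      using compose_Bij[OF B] E v e c by (auto simp: graph_auts_def compose_eq subset_iff)
    then show "\<phi> \<otimes>\<^bsub>BijGroup (verts G)\<^esub> \<psi> \<in> graph_auts G"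
      using B by (simp add: BijGroup_def)
  qed
qed

lemma group_graph_aut_group:
  "edges G \<subseteq> verts G \<times> verts G \<Longrightarrow> group (graph_aut_group G)"
  unfolding graph_aut_group_def
  by (rule subgroup.subgroup_is_group[OF graph_auts_subgroup group_BijGroup])

lemma hamiltonian_graph_edges_subset:
  "edges (hamiltonian_graph n m c p) \<subseteq>
     verts (hamiltonian_graph n m c p) \<times> verts (hamiltonian_graph n m c p)"
  by (auto simp: hamiltonian_graph_def hamiltonian_edges_def Let_def)

lemma dim_pauli_mat [simp]: "dim_row (pauli_mat a) = 2" "dim_col (pauli_mat a) = 2"
  by (cases a; simp add: mat_of_rows_list_def)+

lemma dim_pauli_op [simp]: "dim_row (pauli_op n p) = 2 ^ n" "dim_col (pauli_op n p) = 2 ^ n"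
  by (induction n) (auto simp: tensor_mat_def)

lemma pauli_op_cong:
  "(\<And>i. i \<in> {1..n} \<Longrightarrow> p i = q i) \<Longrightarrow> pauli_op n p = pauli_op n q"
  by (induction n) auto

lemma pauli_mat_independent:
  assumes "\<And>s t. s < 2 \<Longrightarrow> t < 2 \<Longrightarrow> (\<Sum>a\<in>UNIV. g a * pauli_mat a $$ (s, t)) = 0"
  shows "g a = 0"
proof -
  have U: "(UNIV :: pauli set) = {PI, PX, PY, PZ}"
    using pauli.exhaust by blast
  have 1: "g PI + g PZ = 0" "g PI - g PZ = 0"
    using assms[of 0 0] assms[of 1 1] by (simp_all add: U mat_of_rows_list_def)
  have 2: "g PX - \<i> * g PY = 0" "g PX + \<i> * g PY = 0"
    using assms[of 0 1] assms[of 1 0] by (simp_all add: U mat_of_rows_list_def algebra_simps)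
  have "2 * g PI = (g PI + g PZ) + (g PI - g PZ)" "2 * g PZ = (g PI + g PZ) - (g PI - g PZ)"
    "2 * g PX = (g PX - \<i> * g PY) + (g PX + \<i> * g PY)"
    "2 * (\<i> * g PY) = (g PX + \<i> * g PY) - (g PX - \<i> * g PY)"
    by simp_all
  then show ?thesis unfolding 1 2 by (cases a) simp_all
qed

lemma finite_UNIV_pauli: "finite (UNIV :: pauli set)"
proof -
  have "(UNIV :: pauli set) = {PI, PX, PY, PZ}"
    using pauli.exhaust by blast
  then show ?thesis by (metis finite.emptyI finite.insertI)
qed

lemma finite_pauli_strings: "finite (pauli_strings n)"
  unfolding pauli_strings_def by (rule finite_PiE) (auto simp: finite_UNIV_pauli)

lemma sum_pauli_strings_Suc:
  "(\<Sum>q\<in>pauli_strings (Suc n). h q) = (\<Sum>a\<in>UNIV. \<Sum>q\<in>pauli_strings n. h (q(Suc n := a)))"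
proof -
  have eq: "pauli_strings (Suc n) = (\<lambda>(a, q). q(Suc n := a)) ` (UNIV \<times> pauli_strings n)"
    unfolding pauli_strings_def
    using PiE_insert_eq[of "Suc n" "{1..n}" "\<lambda>_. UNIV :: pauli set"]
    by (simp add: atLeastAtMostSuc_conv)
  have inj: "inj_on (\<lambda>(a, q). q(Suc n := a)) (UNIV \<times> pauli_strings n)"
    unfolding pauli_strings_def by (rule inj_combinator) simp
  show ?thesis
    unfolding eq sum.reindex[OF inj] by (simp add: sum.cartesian_product split_def)
qed

lemma pauli_op_independent:
  assumes "\<And>i j. i < 2 ^ n \<Longrightarrow> j < 2 ^ n \<Longrightarrow> (\<Sum>q\<in>pauli_strings n. f q * pauli_op n q $$ (i, j)) = 0"
    and "q \<in> pauli_strings n"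
  shows "f q = 0"
  using assms
proof (induction n arbitrary: f q)
  case 0
  then show ?case by (simp add: pauli_strings_def)
next
  case (Suc n)
  have "(\<Sum>q\<in>pauli_strings n. f (q(Suc n := a)) * pauli_op n q $$ (i, j)) = 0"
    if ij: "i < 2 ^ n" "j < 2 ^ n" for a i j
  proof (rule pauli_mat_independent
      [where g = "\<lambda>a. \<Sum>q\<in>pauli_strings n. f (q(Suc n := a)) * pauli_op n q $$ (i, j)"])
    fix s t :: nat assume st: "s < 2" "t < 2"
    have b: "2 * i + s < 2 ^ Suc n" "2 * j + t < 2 ^ Suc n" using ij st by auto
    have op: "pauli_op (Suc n) (q(Suc n := a)) $$ (2 * i + s, 2 * j + t)
        = pauli_op n q $$ (i, j) * pauli_mat a $$ (s, t)" for q a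
    proof -
      have "pauli_op n (q(Suc n := a)) = pauli_op n q" by (rule pauli_op_cong) auto
      then show ?thesis using b st by (simp add: tensor_mat_def mult.commute)
    qed
    show "(\<Sum>a\<in>UNIV. (\<Sum>q\<in>pauli_strings n. f (q(Suc n := a)) * pauli_op n q $$ (i, j))
        * pauli_mat a $$ (s, t)) = 0"
      using Suc.prems(1)[OF b] unfolding sum_pauli_strings_Suc op
      by (simp add: sum_distrib_right mult.assoc)
  qed
  then have IH: "f (q(Suc n := a)) = 0" if "q \<in> pauli_strings n" for a q
    using Suc.IH[of "\<lambda>q. f (q(Suc n := a))"] that by blast
  have "q(Suc n := undefined) \<in> pauli_strings n"
    using Suc.prems(2) by (auto simp: pauli_strings_def PiE_iff extensional_def)
  from IH[OF this, of "q (Suc n)"] show ?case by simp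
qed

lemma hamiltonian_eq_iff:
  assumes p: "\<And>r. r \<in> {1..m} \<Longrightarrow> p r \<in> pauli_strings n" "inj_on p {1..m}"
    and q: "\<And>r. r \<in> {1..m} \<Longrightarrow> q r \<in> pauli_strings n" "inj_on q {1..m}"
    and c: "\<And>r. r \<in> {1..m} \<Longrightarrow> c r \<noteq> 0"
  shows "hamiltonian n m c q = hamiltonian n m c p \<longleftrightarrow>
    (\<lambda>r. (c r, q r)) ` {1..m} = (\<lambda>r. (c r, p r)) ` {1..m}"
proof
  define k where "k p s = (\<Sum>r | r \<in> {1..m} \<and> p r = s. c r)" for p and s :: "nat \<Rightarrow> pauli"
  have expand: "(\<Sum>r=1..m. c r * pauli_op n (p r) $$ ij)
      = (\<Sum>s\<in>pauli_strings n. k p s * pauli_op n s $$ ij)"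
    if p: "\<And>r. r \<in> {1..m} \<Longrightarrow> p r \<in> pauli_strings n" for p ij
  proof -
    have "(\<Sum>s\<in>pauli_strings n. k p s * pauli_op n s $$ ij)
        = (\<Sum>s\<in>pauli_strings n. \<Sum>r | r \<in> {1..m} \<and> p r = s. c r * pauli_op n (p r) $$ ij)"
      by (auto simp: k_def sum_distrib_right intro!: sum.cong)
    also have "\<dots> = (\<Sum>r=1..m. c r * pauli_op n (p r) $$ ij)"
      using p by (intro sum.group[where g = p]) (auto simp: finite_pauli_strings)
    finally show ?thesis by simp
  qed
  have k_single: "k p (p r) = c r" if "inj_on p {1..m}" "r \<in> {1..m}" for p r
  proof -
    have "{r' \<in> {1..m}. p r' = p r} = {r}" using that by (blast dest: inj_onD)
    then show ?thesis unfolding k_def by (simp only:) simp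
  qed
  have k_zero: "k p s = 0" if "s \<notin> p ` {1..m}" for p s
  proof -
    have "{r \<in> {1..m}. p r = s} = {}" using that by auto
    then show ?thesis unfolding k_def by (simp only: sum.empty)
  qed
  have incl: "(\<lambda>r. (c r, p r)) ` {1..m} \<subseteq> (\<lambda>r. (c r, q r)) ` {1..m}"
    if k: "\<And>s. s \<in> pauli_strings n \<Longrightarrow> k p s = k q s"
      and p: "\<And>r. r \<in> {1..m} \<Longrightarrow> p r \<in> pauli_strings n" "inj_on p {1..m}"
      and q: "inj_on q {1..m}" for p q
  proof
    fix x assume "x \<in> (\<lambda>r. (c r, p r)) ` {1..m}"
    then obtain r where r: "r \<in> {1..m}" and x: "x = (c r, p r)" by auto
    have kq: "k q (p r) = c r" using k[OF p(1)[OF r]] k_single[OF p(2) r] by simp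
    then have "p r \<in> q ` {1..m}" using k_zero[of "p r" q] c[OF r] by metis
    then obtain r' where r': "r' \<in> {1..m}" "p r = q r'" by blast
    then have "c r' = c r" using kq k_single[OF q r'(1)] by simp
    then have "x = (c r', q r')" using r' x by simp
    then show "x \<in> (\<lambda>r. (c r, q r)) ` {1..m}" using r'(1) by blast
  qed
  {
    assume H: "hamiltonian n m c q = hamiltonian n m c p"
    have eq: "k p s = k q s" if s: "s \<in> pauli_strings n" for s
    proof -
      have "k p s - k q s = 0"
      proof (rule pauli_op_independent[where f = "\<lambda>s. k p s - k q s", OF _ s])
        fix i j :: nat assume ij: "i < 2 ^ n" "j < 2 ^ n"
        have "hamiltonian n m c q $$ (i, j) = hamiltonian n m c p $$ (i, j)" using H by simp
        then show "(\<Sum>s\<in>pauli_strings n. (k p s - k q s) * pauli_op n s $$ (i, j)) = 0"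
          using ij expand[OF p(1)] expand[OF q(1)]
          by (simp add: hamiltonian_def left_diff_distrib sum_subtractf)
      qed
      then show ?thesis by simp
    qed
    show "(\<lambda>r. (c r, q r)) ` {1..m} = (\<lambda>r. (c r, p r)) ` {1..m}"
      using incl[OF eq p q(2)] incl[OF eq[symmetric] q p(2)] by blast
  }
  assume T: "(\<lambda>r. (c r, q r)) ` {1..m} = (\<lambda>r. (c r, p r)) ` {1..m}"
  have inj: "inj_on (\<lambda>r. (c r, p r)) {1..m}" "inj_on (\<lambda>r. (c r, q r)) {1..m}"
    using p(2) q(2) unfolding inj_on_def by blast+
  have "(\<Sum>r=1..m. c r * pauli_op n (q r) $$ ij) = (\<Sum>r=1..m. c r * pauli_op n (p r) $$ ij)" for ij
    using sum.reindex[OF inj(1), of "\<lambda>(a, s). a * pauli_op n s $$ ij"]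
      sum.reindex[OF inj(2), of "\<lambda>(a, s). a * pauli_op n s $$ ij"] T by simp
  then show "hamiltonian n m c q = hamiltonian n m c p" by (simp add: hamiltonian_def)
qed

lemma perm_string_in: "perm_string n \<sigma> p \<in> pauli_strings n"
  by (simp add: perm_string_def pauli_strings_def)

lemma perm_string_comp:
  assumes "\<sigma> permutes {1..n}" "\<tau> permutes {1..n}"
  shows "perm_string n (\<sigma> \<circ> \<tau>) p = perm_string n \<sigma> (perm_string n \<tau> p)"
proof
  fix j
  show "perm_string n (\<sigma> \<circ> \<tau>) p j = perm_string n \<sigma> (perm_string n \<tau> p) j"
    using permutes_in_image[OF permutes_inv[OF assms(1)], of j]
    by (simp add: perm_string_def o_inv_distrib permutes_bij[OF assms(1)] permutes_bij[OF assms(2)])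
qed

lemma perm_string_id: "p \<in> pauli_strings n \<Longrightarrow> perm_string n id p = p"
  by (auto simp: perm_string_def pauli_strings_def PiE_iff extensional_def fun_eq_iff)

lemma perm_string_inj:
  assumes "\<sigma> permutes {1..n}"
  shows "inj_on (perm_string n \<sigma>) (pauli_strings n)"
proof (rule inj_on_inverseI)
  fix p assume "p \<in> pauli_strings n"
  then show "perm_string n (inv' \<sigma>) (perm_string n \<sigma> p) = p"
    using perm_string_comp[OF permutes_inv[OF assms] assms, of p] perm_string_id[of p n]
    by (simp add: permutes_inv_o[OF assms])
qed

text \<open>Invariance of the operator agrees with invariance of the set of pairs (coefficient, string).\<close>

lemma perm_symmetries_iff:
  assumes p: "\<And>r. r \<in> {1..m} \<Longrightarrow> p r \<in> pauli_strings n" "inj_on p {1..m}"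
    and c: "\<And>r. r \<in> {1..m} \<Longrightarrow> c r \<noteq> 0"
  defines "T \<equiv> (\<lambda>r. (c r, p r)) ` {1..m}"
  shows "\<sigma> \<in> perm_symmetries n m c p \<longleftrightarrow>
    \<sigma> permutes {1..n} \<and> (\<lambda>(a, s). (a, perm_string n \<sigma> s)) ` T = T"
proof -
  have "hamiltonian n m c (\<lambda>r. perm_string n \<sigma> (p r)) = hamiltonian n m c p \<longleftrightarrow>
      (\<lambda>r. (c r, perm_string n \<sigma> (p r))) ` {1..m} = T" if \<sigma>: "\<sigma> permutes {1..n}"
  proof -
    have "inj_on (\<lambda>r. perm_string n \<sigma> (p r)) {1..m}"
      using perm_string_inj[OF \<sigma>] p unfolding inj_on_def by blast
    then show ?thesis
      unfolding T_def by (intro hamiltonian_eq_iff p c perm_string_in)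
  qed
  then show ?thesis
    by (simp add: perm_symmetries_def T_def image_image cong: conj_cong)
qed

lemma perm_symmetries_subgroup:
  assumes p: "\<And>r. r \<in> {1..m} \<Longrightarrow> p r \<in> pauli_strings n" "inj_on p {1..m}"
    and c: "\<And>r. r \<in> {1..m} \<Longrightarrow> c r \<noteq> 0"
  shows "subgroup (perm_symmetries n m c p) (sym_group n)"
proof -
  interpret S: group "sym_group n" by (rule sym_group_is_group)
  define T where "T = (\<lambda>r. (c r, p r)) ` {1..m}"
  define A where "A \<sigma> = (\<lambda>(a :: complex, s). (a, perm_string n \<sigma> s))" for \<sigma>
  have iff: "\<sigma> \<in> perm_symmetries n m c p \<longleftrightarrow> \<sigma> permutes {1..n} \<and> A \<sigma> ` T = T" for \<sigma>
    unfolding A_def T_def by (rule perm_symmetries_iff[OF p c])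
  have A_comp: "A (\<sigma> \<circ> \<tau>) ` T = A \<sigma> ` A \<tau> ` T" if "\<sigma> permutes {1..n}" "\<tau> permutes {1..n}" for \<sigma> \<tau>
    unfolding image_image by (rule image_cong) (auto simp: A_def perm_string_comp[OF that])
  have A_id: "A id ` T = T"
    using p by (force simp: A_def T_def perm_string_id image_image)
  show ?thesis
  proof (rule S.subgroupI)
    show "perm_symmetries n m c p \<subseteq> carrier (sym_group n)"
      by (auto simp: sym_group_carrier iff)
    show "perm_symmetries n m c p \<noteq> {}"
      using iff[of id] A_id permutes_id by blast
  next
    fix \<sigma> assume \<sigma>: "\<sigma> \<in> perm_symmetries n m c p"
    then have P: "\<sigma> permutes {1..n}" by (simp add: iff)
    have P': "inv' \<sigma> permutes {1..n}" by (rule permutes_inv[OF P])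
    have "A (inv' \<sigma>) ` T = A (inv' \<sigma>) ` A \<sigma> ` T" using \<sigma> by (simp add: iff)
    also have "\<dots> = T" using A_comp[OF P' P] A_id by (simp add: permutes_inv_o[OF P])
    finally have "inv' \<sigma> \<in> perm_symmetries n m c p" using P' by (simp add: iff)
    moreover have "inv\<^bsub>sym_group n\<^esub> \<sigma> = inv' \<sigma>"
      using P P' by (intro S.inv_equality)
        (auto simp: sym_group_carrier sym_group_mult sym_group_one permutes_inv_o)
    ultimately show "inv\<^bsub>sym_group n\<^esub> \<sigma> \<in> perm_symmetries n m c p" by simp
  next
    fix \<sigma> \<tau> assume "\<sigma> \<in> perm_symmetries n m c p" "\<tau> \<in> perm_symmetries n m c p"
    then show "\<sigma> \<otimes>\<^bsub>sym_group n\<^esub> \<tau> \<in> perm_symmetries n m c p"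
      by (simp add: iff sym_group_mult permutes_compose A_comp)
  qed
qed

lemma group_perm_symmetry_group:
  assumes "\<And>r. r \<in> {1..m} \<Longrightarrow> p r \<in> pauli_strings n" "inj_on p {1..m}"
    and "\<And>r. r \<in> {1..m} \<Longrightarrow> c r \<noteq> 0"
  shows "group (perm_symmetry_group n m c p)"
  unfolding perm_symmetry_group_def
  by (rule subgroup.subgroup_is_group[OF perm_symmetries_subgroup[OF assms] sym_group_is_group])

end

theory Submission
  imports Defs
begin

text \<open>Distinctness of the strings lets a symmetry \<open>\<sigma>\<close> act on the term nodes: \<open>t\<^sub>r\<close> goes to the
  unique term node carrying the string \<open>\<sigma>(p\<^sub>r)\<close>. Conversely, an automorphism preserves the two
  kinds of nodes, hence consists of a permutation \<open>\<sigma>\<close> of the qubits and a permutation \<open>\<tau>\<close> of the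
  terms. Since non-edges correspond to the operator \<open>I\<close>, preserving edges and their colours
  means \<open>[p\<^bsub>\<tau> r\<^esub>]\<^bsub>\<sigma> i\<^esub> = [p\<^sub>r]\<^sub>i\<close> for all \<open>i\<close> and \<open>r\<close>, that is, \<open>p\<^bsub>\<tau> r\<^esub> = \<sigma>(p\<^sub>r)\<close>. So \<open>\<sigma>\<close> is a
  symmetry and determines \<open>\<tau>\<close>.\<close>

text \<open>Every qubit has the form \<open>\<sigma> i\<close>, so the values there determine an
  extensional string. This turns operator-by-operator identities between terms into equations of
  strings.\<close>

lemma perm_string_eqI:
  assumes "\<sigma> permutes {1..n}" "q \<in> pauli_strings n"
    and "\<And>i. i \<in> {1..n} \<Longrightarrow> q (\<sigma> i) = s i"
  shows "perm_string n \<sigma> s = q"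
proof (rule PiE_ext)
  show "perm_string n \<sigma> s \<in> {1..n} \<rightarrow>\<^sub>E UNIV" "q \<in> {1..n} \<rightarrow>\<^sub>E UNIV"
    using perm_string_in assms(2) by (auto simp: pauli_strings_def)
next
  fix j assume "j \<in> {1..n}"
  then obtain i where "i \<in> {1..n}" "j = \<sigma> i"
    using permutes_image[OF assms(1)] by blast
  then show "perm_string n \<sigma> s j = q j"
    using assms by (simp add: perm_string_apply del: atLeastAtMost_iff)
qed

section \<open>Node maps assembled from a qubit and a term permutation\<close>

text \<open>Restricted to the node set because \<open>Bij\<close> consists of extensional maps; the
  values of \<open>\<sigma>\<close> and \<open>\<tau>\<close> outside their index ranges therefore
  have no influence.\<close>

definition node_map :: "nat \<Rightarrow> nat \<Rightarrow> (nat \<Rightarrow> nat) \<Rightarrow> (nat \<Rightarrow> nat) \<Rightarrow> node \<Rightarrow> node" where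
  "node_map n m \<sigma> \<tau> = (\<lambda>v\<in>Qubit ` {1..n} \<union> Term ` {1..m}.
     case v of Qubit i \<Rightarrow> Qubit (\<sigma> i) | Term r \<Rightarrow> Term (\<tau> r))"

lemma node_map_simps [simp]:
  "i \<in> {1..n} \<Longrightarrow> node_map n m \<sigma> \<tau> (Qubit i) = Qubit (\<sigma> i)"
  "r \<in> {1..m} \<Longrightarrow> node_map n m \<sigma> \<tau> (Term r) = Term (\<tau> r)"
  by (auto simp: node_map_def)

lemma node_map_in_Bij:
  assumes "bij_betw \<sigma> {1..n} {1..n}" "bij_betw \<tau> {1..m} {1..m}"
  shows "node_map n m \<sigma> \<tau> \<in> Bij (Qubit ` {1..n} \<union> Term ` {1..m})"
proof -
  let ?f = "node_map n m \<sigma> \<tau>"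
  have Q: "bij_betw ?f (Qubit ` {1..n}) (Qubit ` {1..n})"
  proof (rule bij_betw_imageI)
    show "inj_on ?f (Qubit ` {1..n})"
      using assms(1) by (auto simp: bij_betw_def inj_on_def simp del: atLeastAtMost_iff)
    have "?f ` Qubit ` {1..n} = Qubit ` \<sigma> ` {1..n}"
      unfolding image_image by (rule image_cong) simp_all
    then show "?f ` Qubit ` {1..n} = Qubit ` {1..n}"
      using assms(1) by (simp add: bij_betw_def)
  qed
  have T: "bij_betw ?f (Term ` {1..m}) (Term ` {1..m})"
  proof (rule bij_betw_imageI)
    show "inj_on ?f (Term ` {1..m})"
      using assms(2) by (auto simp: bij_betw_def inj_on_def simp del: atLeastAtMost_iff)
    have "?f ` Term ` {1..m} = Term ` \<tau> ` {1..m}"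
      unfolding image_image by (rule image_cong) simp_all
    then show "?f ` Term ` {1..m} = Term ` {1..m}"
      using assms(2) by (simp add: bij_betw_def)
  qed
  have "bij_betw ?f (Qubit ` {1..n} \<union> Term ` {1..m}) (Qubit ` {1..n} \<union> Term ` {1..m})"
    by (rule bij_betw_combine[OF Q T]) auto
  then show ?thesis by (simp add: Bij_def node_map_def)
qed

lemma hamiltonian_edges_simps [simp]:
  "(Qubit i, Term r) \<in> hamiltonian_edges n m p \<longleftrightarrow> i \<in> {1..n} \<and> r \<in> {1..m} \<and> p r i \<noteq> PI"
  "(Term r, Qubit i) \<in> hamiltonian_edges n m p \<longleftrightarrow> i \<in> {1..n} \<and> r \<in> {1..m} \<and> p r i \<noteq> PI"
  "(Qubit i, Qubit j) \<notin> hamiltonian_edges n m p"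
  "(Term r, Term s) \<notin> hamiltonian_edges n m p"
  by (auto simp: hamiltonian_edges_def Let_def)

text \<open>The string equation read at qubit \<open>\<sigma> i\<close> becomes
  \<open>p (\<tau> r) (\<sigma> i) = p r i\<close>. This one identity preserves edges, where the
  operator is not \<open>PI\<close>, as well as their colours.\<close>

lemma node_map_in_graph_auts:
  assumes \<sigma>: "\<sigma> permutes {1..n}" and \<tau>: "bij_betw \<tau> {1..m} {1..m}"
    and c: "\<And>r. r \<in> {1..m} \<Longrightarrow> c (\<tau> r) = c r"
    and p: "\<And>r. r \<in> {1..m} \<Longrightarrow> p (\<tau> r) = perm_string n \<sigma> (p r)"
  shows "node_map n m \<sigma> \<tau> \<in> graph_auts (hamiltonian_graph n m c p)"
proof -
  have mem: "\<sigma> i \<in> {1..n}" if "i \<in> {1..n}" for i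
    using permutes_in_image[OF \<sigma>] that by blast
  have mem': "\<tau> r \<in> {1..m}" if "r \<in> {1..m}" for r
    using \<tau> that by (rule bij_betwE[rule_format])
  have eq: "p (\<tau> r) (\<sigma> i) = p r i" if "r \<in> {1..m}" "i \<in> {1..n}" for r i
    using p[OF that(1)] perm_string_apply[OF \<sigma> that(2)] by simp
  \<comment> \<open>Edges occur in both orientations, and \<open>edge_colour_of\<close> is
    \<open>undefined\<close> on two nodes of the same kind.\<close>
  have edge: "(u, v) \<in> hamiltonian_edges n m p \<Longrightarrow>
      (\<exists>i\<in>{1..n}. \<exists>r\<in>{1..m}. u = Qubit i \<and> v = Term r \<or> u = Term r \<and> v = Qubit i)" for u v
    by (cases u; cases v) (auto simp del: atLeastAtMost_iff)
  have "\<forall>(u, v)\<in>hamiltonian_edges n m p.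
      edge_colour_of p (node_map n m \<sigma> \<tau> u, node_map n m \<sigma> \<tau> v) = edge_colour_of p (u, v)"
    by (auto dest!: edge simp: eq simp del: atLeastAtMost_iff)
  then show ?thesis
    using node_map_in_Bij[OF permutes_imp_bij[OF \<sigma>] \<tau>]
    unfolding graph_auts_def hamiltonian_graph_def
    by (auto simp: mem mem' eq c simp del: atLeastAtMost_iff One_nat_def)
qed

section \<open>Decomposition of an automorphism\<close>

text \<open>Vertex colours keep the two kinds of nodes apart and fix coefficients. The induced index
  maps inherit injectivity from \<open>\<phi>\<close>, hence are bijective by finiteness.\<close>

lemma graph_autE:
  assumes p: "\<And>r. r \<in> {1..m} \<Longrightarrow> p r \<in> pauli_strings n"
    and \<phi>: "\<phi> \<in> graph_auts (hamiltonian_graph n m c p)"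
  obtains \<sigma> \<tau> where "\<sigma> permutes {1..n}" "bij_betw \<tau> {1..m} {1..m}"
    "\<And>r. r \<in> {1..m} \<Longrightarrow> c (\<tau> r) = c r"
    "\<And>r. r \<in> {1..m} \<Longrightarrow> p (\<tau> r) = perm_string n \<sigma> (p r)"
    "\<phi> = node_map n m \<sigma> \<tau>"
proof -
  let ?V = "Qubit ` {1..n} \<union> Term ` {1..m}"
  have B: "bij_betw \<phi> ?V ?V" and ext: "\<phi> \<in> extensional ?V"
    and edge: "\<And>u v. u \<in> ?V \<Longrightarrow> v \<in> ?V \<Longrightarrow>
      (\<phi> u, \<phi> v) \<in> hamiltonian_edges n m p \<longleftrightarrow> (u, v) \<in> hamiltonian_edges n m p"
    and vcol: "\<And>v. v \<in> ?V \<Longrightarrow> node_colour_of c (\<phi> v) = node_colour_of c v"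
    and ecol: "\<And>u v. (u, v) \<in> hamiltonian_edges n m p \<Longrightarrow>
      edge_colour_of p (\<phi> u, \<phi> v) = edge_colour_of p (u, v)"
    using \<phi> by (auto simp: graph_auts_def hamiltonian_graph_def Bij_def)
  have V: "\<phi> v \<in> ?V" if "v \<in> ?V" for v
    using B that by (rule bij_betwE[rule_format])
  have Q: "\<exists>j\<in>{1..n}. \<phi> (Qubit i) = Qubit j" if "i \<in> {1..n}" for i
    using V[of "Qubit i"] vcol[of "Qubit i"] that by auto
  have T: "\<exists>s\<in>{1..m}. \<phi> (Term r) = Term s \<and> c s = c r" if "r \<in> {1..m}" for r
    using V[of "Term r"] vcol[of "Term r"] that by auto
  obtain f where f: "\<And>i. i \<in> {1..n} \<Longrightarrow> f i \<in> {1..n} \<and> \<phi> (Qubit i) = Qubit (f i)"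
    using Q by metis
  obtain \<tau> where \<tau>: "\<And>r. r \<in> {1..m} \<Longrightarrow> \<tau> r \<in> {1..m} \<and> \<phi> (Term r) = Term (\<tau> r) \<and> c (\<tau> r) = c r"
    using T by metis
  \<comment> \<open>The choice function \<open>f\<close> is arbitrary outside \<open>{1..n}\<close>,
    whereas \<open>permutes\<close> demands the identity there.\<close>
  define \<sigma> where "\<sigma> i = (if i \<in> {1..n} then f i else i)" for i
  have \<sigma>: "\<sigma> i \<in> {1..n}" "\<phi> (Qubit i) = Qubit (\<sigma> i)" if "i \<in> {1..n}" for i
    using f[OF that] that by (auto simp: \<sigma>_def)
  have inj: "inj_on \<phi> ?V" using B by (rule bij_betw_imp_inj_on)
  have "inj_on \<sigma> {1..n}"
  proof (rule inj_onI)
    fix i j assume "i \<in> {1..n}" "j \<in> {1..n}" "\<sigma> i = \<sigma> j"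
    then show "i = j" using inj_onD[OF inj, of "Qubit i" "Qubit j"] \<sigma>(2) by auto
  qed
  then have "bij_betw \<sigma> {1..n} {1..n}"
    using \<sigma>(1) by (intro bij_betw_imageI endo_inj_surj) auto
  then have P: "\<sigma> permutes {1..n}"
    by (rule bij_imp_permutes) (simp add: \<sigma>_def del: atLeastAtMost_iff)
  have "inj_on \<tau> {1..m}"
  proof (rule inj_onI)
    fix r s assume "r \<in> {1..m}" "s \<in> {1..m}" "\<tau> r = \<tau> s"
    then show "r = s" using inj_onD[OF inj, of "Term r" "Term s"] \<tau>[of r] \<tau>[of s] by auto
  qed
  then have \<tau>_bij: "bij_betw \<tau> {1..m} {1..m}"
    using \<tau> by (intro bij_betw_imageI endo_inj_surj) auto
  have eq: "p (\<tau> r) (\<sigma> i) = p r i" if "r \<in> {1..m}" "i \<in> {1..n}" for r i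
  proof (cases "p r i = PI")
    \<comment> \<open>The pair is a non-edge, hence so is its image; as the image nodes lie in
      range, the operator there must be \<open>PI\<close>.\<close>
    case True
    then show ?thesis using edge[of "Qubit i" "Term r"] \<sigma>[OF that(2)] \<tau>[OF that(1)] that by auto
  next
    case False
    then show ?thesis using ecol[of "Qubit i" "Term r"] \<sigma>[OF that(2)] \<tau>[OF that(1)] that by auto
  qed
  have "p (\<tau> r) = perm_string n \<sigma> (p r)" if "r \<in> {1..m}" for r
    using perm_string_eqI[OF P p eq] \<tau> that by simp
  moreover have "\<phi> = node_map n m \<sigma> \<tau>"
  proof (rule extensionalityI[OF ext])
    show "node_map n m \<sigma> \<tau> \<in> extensional ?V" by (simp add: node_map_def)
    show "\<phi> v = node_map n m \<sigma> \<tau> v" if "v \<in> ?V" for v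
      using that \<sigma> \<tau> by (auto simp del: atLeastAtMost_iff)
  qed
  ultimately show ?thesis using that P \<tau>_bij \<tau> by blast
qed

section \<open>The term permutation induced by a symmetry\<close>

text \<open>The index of the permuted string in the list \<open>p\<close>; meaningful only if that
  string occurs, as it does for symmetries.\<close>

definition term_perm :: "nat \<Rightarrow> nat \<Rightarrow> (nat \<Rightarrow> nat \<Rightarrow> pauli) \<Rightarrow> (nat \<Rightarrow> nat) \<Rightarrow> nat \<Rightarrow> nat" where
  "term_perm n m p \<sigma> r = inv_into {1..m} p (perm_string n \<sigma> (p r))"

lemma term_perm_eqI:
  assumes "inj_on p {1..m}" "s \<in> {1..m}" "p s = perm_string n \<sigma> (p r)"
  shows "term_perm n m p \<sigma> r = s"
  using assms(1,2) unfolding term_perm_def assms(3)[symmetric] by (rule inv_into_f_f)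

lemma perm_symmetries_iff_image:
  assumes "\<And>r. r \<in> {1..m} \<Longrightarrow> p r \<in> pauli_strings n" "inj_on p {1..m}"
    and "\<And>r. r \<in> {1..m} \<Longrightarrow> c r \<noteq> 0"
  shows "\<sigma> \<in> perm_symmetries n m c p \<longleftrightarrow> \<sigma> permutes {1..n} \<and>
    (\<lambda>r. (c r, perm_string n \<sigma> (p r))) ` {1..m} = (\<lambda>r. (c r, p r)) ` {1..m}"
proof -
  have "\<sigma> \<in> perm_symmetries n m c p \<longleftrightarrow> \<sigma> permutes {1..n} \<and>
      (\<lambda>(a, s). (a, perm_string n \<sigma> s)) ` (\<lambda>r. (c r, p r)) ` {1..m} = (\<lambda>r. (c r, p r)) ` {1..m}"
    by (rule perm_symmetries_iff[OF assms])
  then show ?thesis by (simp add: image_image)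
qed

text \<open>Invariance of the term set supplies an index with the same coefficient and the permuted
  string; distinctness identifies it with \<open>term_perm\<close>. Injectivity holds because
  \<open>\<sigma>\<close> acts injectively on strings.\<close>

lemma perm_symmetries_term_perm:
  assumes p: "\<And>r. r \<in> {1..m} \<Longrightarrow> p r \<in> pauli_strings n" "inj_on p {1..m}"
    and c: "\<And>r. r \<in> {1..m} \<Longrightarrow> c r \<noteq> 0"
    and \<sigma>: "\<sigma> \<in> perm_symmetries n m c p"
  shows "\<sigma> permutes {1..n}" "bij_betw (term_perm n m p \<sigma>) {1..m} {1..m}"
    and "\<And>r. r \<in> {1..m} \<Longrightarrow> c (term_perm n m p \<sigma> r) = c r"
    and "\<And>r. r \<in> {1..m} \<Longrightarrow> p (term_perm n m p \<sigma> r) = perm_string n \<sigma> (p r)"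
proof -
  let ?\<tau> = "term_perm n m p \<sigma>"
  have T: "(\<lambda>r. (c r, perm_string n \<sigma> (p r))) ` {1..m} = (\<lambda>r. (c r, p r)) ` {1..m}"
    and P: "\<sigma> permutes {1..n}"
    using \<sigma> perm_symmetries_iff_image[where \<sigma> = \<sigma>, of m p n c] p c by blast+
  have \<tau>: "?\<tau> r \<in> {1..m} \<and> c (?\<tau> r) = c r \<and> p (?\<tau> r) = perm_string n \<sigma> (p r)"
    if r: "r \<in> {1..m}" for r
  proof -
    have "(c r, perm_string n \<sigma> (p r)) \<in> (\<lambda>r. (c r, p r)) ` {1..m}"
      using r by (subst T[symmetric]) (rule imageI)
    then obtain s where s: "s \<in> {1..m}" "c s = c r" "p s = perm_string n \<sigma> (p r)" by auto
    then show ?thesis using term_perm_eqI[OF p(2) s(1,3)] by simp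
  qed
  have "inj_on ?\<tau> {1..m}"
  proof (rule inj_onI)
    fix r s assume rs: "r \<in> {1..m}" "s \<in> {1..m}" "?\<tau> r = ?\<tau> s"
    then have "perm_string n \<sigma> (p r) = perm_string n \<sigma> (p s)" using \<tau> by metis
    then have "p r = p s" using perm_string_inj[OF P] p(1) rs by (blast dest: inj_onD)
    then show "r = s" using p(2) rs by (blast dest: inj_onD)
  qed
  then show "bij_betw ?\<tau> {1..m} {1..m}"
    using \<tau> by (intro bij_betw_imageI endo_inj_surj) auto
  show "\<sigma> permutes {1..n}" by (rule P)
  show "c (?\<tau> r) = c r" "p (?\<tau> r) = perm_string n \<sigma> (p r)" if "r \<in> {1..m}" for r
    using \<tau>[OF that] by auto
qed

text \<open>Applying \<open>\<sigma>\<close> to the term set amounts to reindexing it along the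
  bijection \<open>\<tau>\<close>, which leaves the set unchanged.\<close>

lemma perm_symmetriesI:
  assumes p: "\<And>r. r \<in> {1..m} \<Longrightarrow> p r \<in> pauli_strings n" "inj_on p {1..m}"
    and c: "\<And>r. r \<in> {1..m} \<Longrightarrow> c r \<noteq> 0"
    and \<sigma>: "\<sigma> permutes {1..n}" and \<tau>: "bij_betw \<tau> {1..m} {1..m}"
    and c\<tau>: "\<And>r. r \<in> {1..m} \<Longrightarrow> c (\<tau> r) = c r"
    and p\<tau>: "\<And>r. r \<in> {1..m} \<Longrightarrow> p (\<tau> r) = perm_string n \<sigma> (p r)"
  shows "\<sigma> \<in> perm_symmetries n m c p"
proof -
  have "(\<lambda>r. (c r, perm_string n \<sigma> (p r))) ` {1..m} = (\<lambda>r. (c (\<tau> r), p (\<tau> r))) ` {1..m}"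
    by (rule image_cong) (simp_all add: c\<tau> p\<tau>)
  also have "\<dots> = (\<lambda>r. (c r, p r)) ` \<tau> ` {1..m}" by (simp add: image_image)
  also have "\<dots> = (\<lambda>r. (c r, p r)) ` {1..m}" using \<tau> by (simp add: bij_betw_def)
  finally show ?thesis using \<sigma> perm_symmetries_iff_image[where \<sigma> = \<sigma>, of m p n c] p c by blast
qed

section \<open>The isomorphism\<close>

theorem proposition1:
  fixes n m :: nat and c :: "nat \<Rightarrow> complex" and p :: "nat \<Rightarrow> nat \<Rightarrow> pauli"
  assumes "\<And>r. r \<in> {1..m} \<Longrightarrow> p r \<in> pauli_strings n"
    and "inj_on p {1..m}"
    and "\<And>r. r \<in> {1..m} \<Longrightarrow> c r \<noteq> 0"
  shows "perm_symmetry_group n m c p \<cong> graph_aut_group (hamiltonian_graph n m c p)"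
proof -
  define \<Phi> where "\<Phi> \<sigma> = node_map n m \<sigma> (term_perm n m p \<sigma>)" for \<sigma>
  let ?S = "perm_symmetries n m c p" and ?A = "graph_auts (hamiltonian_graph n m c p)"
  let ?V = "Qubit ` {1..n} \<union> Term ` {1..m}"
  have sym: "\<sigma> permutes {1..n}" "bij_betw (term_perm n m p \<sigma>) {1..m} {1..m}"
    "\<And>r. r \<in> {1..m} \<Longrightarrow> c (term_perm n m p \<sigma> r) = c r"
    "\<And>r. r \<in> {1..m} \<Longrightarrow> p (term_perm n m p \<sigma> r) = perm_string n \<sigma> (p r)"
    if "\<sigma> \<in> ?S" for \<sigma>
    using perm_symmetries_term_perm[where \<sigma> = \<sigma>] assms that by blast+
  have verts: "verts (hamiltonian_graph n m c p) = ?V" by (simp add: hamiltonian_graph_def)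
  have \<Phi>: "\<Phi> \<sigma> \<in> ?A" if "\<sigma> \<in> ?S" for \<sigma>
    unfolding \<Phi>_def by (rule node_map_in_graph_auts) (use sym[OF that] in auto)
  have mult: "\<Phi> (\<sigma> \<circ> \<tau>) = compose ?V (\<Phi> \<sigma>) (\<Phi> \<tau>)" if \<sigma>: "\<sigma> \<in> ?S" and \<tau>: "\<tau> \<in> ?S" for \<sigma> \<tau>
  proof (rule extensionalityI)
    show "\<Phi> (\<sigma> \<circ> \<tau>) \<in> extensional ?V" by (simp add: \<Phi>_def node_map_def)
    show "compose ?V (\<Phi> \<sigma>) (\<Phi> \<tau>) \<in> extensional ?V" by (rule compose_extensional)
    fix v assume v: "v \<in> ?V"
    show "\<Phi> (\<sigma> \<circ> \<tau>) v = compose ?V (\<Phi> \<sigma>) (\<Phi> \<tau>) v"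
    proof (cases v)
      case (Qubit i)
      then have "i \<in> {1..n}" "\<tau> i \<in> {1..n}"
        using v permutes_in_image[OF sym(1)[OF \<tau>], of i] by auto
      then show ?thesis using v Qubit by (simp add: compose_eq \<Phi>_def del: atLeastAtMost_iff)
    next
      case (Term r)
      then have r: "r \<in> {1..m}" using v by auto
      have r': "term_perm n m p \<tau> r \<in> {1..m}"
        using sym(2)[OF \<tau>] r by (rule bij_betwE[rule_format])
      \<comment> \<open>Both sides are the index of the string obtained from \<open>p r\<close> by
        applying first \<open>\<tau>\<close>, then \<open>\<sigma>\<close>.\<close>
      have "term_perm n m p (\<sigma> \<circ> \<tau>) r = term_perm n m p \<sigma> (term_perm n m p \<tau> r)"
        by (simp add: term_perm_def[of n m p "\<sigma> \<circ> \<tau>"] term_perm_def[of n m p \<sigma>] sym(4)[OF \<tau> r]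
            perm_string_comp[OF sym(1)[OF \<sigma>] sym(1)[OF \<tau>]])
      then show ?thesis using v Term r r' by (simp add: compose_eq \<Phi>_def del: atLeastAtMost_iff)
    qed
  qed
  have "inj_on \<Phi> ?S"
  proof (rule inj_onI)
    fix \<sigma> \<tau> assume \<sigma>: "\<sigma> \<in> ?S" and \<tau>: "\<tau> \<in> ?S" and eq: "\<Phi> \<sigma> = \<Phi> \<tau>"
    show "\<sigma> = \<tau>"
    proof
      fix i show "\<sigma> i = \<tau> i"
      \<comment> \<open>Equality of the node maps only speaks about qubits in range; elsewhere both
        permutations are the identity.\<close>
      proof (cases "i \<in> {1..n}")
        case True
        then show ?thesis using fun_cong[OF eq, of "Qubit i"] by (simp add: \<Phi>_def del: atLeastAtMost_iff)
      next
        case False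
        then show ?thesis
          using permutes_not_in[OF sym(1)[OF \<sigma>]] permutes_not_in[OF sym(1)[OF \<tau>]] by metis
      qed
    qed
  qed
  moreover have "\<Phi> ` ?S = ?A"
  proof
    show "\<Phi> ` ?S \<subseteq> ?A" using \<Phi> by blast
    show "?A \<subseteq> \<Phi> ` ?S"
    proof
      fix \<phi> assume "\<phi> \<in> ?A"
      then obtain \<sigma> \<tau> where \<sigma>: "\<sigma> permutes {1..n}" and \<tau>: "bij_betw \<tau> {1..m} {1..m}"
        and c: "\<And>r. r \<in> {1..m} \<Longrightarrow> c (\<tau> r) = c r"
        and p: "\<And>r. r \<in> {1..m} \<Longrightarrow> p (\<tau> r) = perm_string n \<sigma> (p r)"
        and \<phi>: "\<phi> = node_map n m \<sigma> \<tau>"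
        using graph_autE[of m p n \<phi> c] assms(1) by blast
      \<comment> \<open>No two term nodes carry the same string, so the term part of
        \<open>\<phi>\<close> is forced by its qubit part.\<close>
      have "term_perm n m p \<sigma> r = \<tau> r" if "r \<in> {1..m}" for r
        using bij_betwE[OF \<tau>] that by (intro term_perm_eqI[OF assms(2) _ p]) auto
      then have "\<phi> = \<Phi> \<sigma>"
        unfolding \<phi> \<Phi>_def node_map_def by (intro restrict_ext) auto
      moreover have "\<sigma> \<in> ?S" by (rule perm_symmetriesI[OF assms \<sigma> \<tau>]) (use c p in auto)
      ultimately show "\<phi> \<in> \<Phi> ` ?S" by blast
    qed
  qed
  moreover have "?A \<subseteq> Bij ?V" by (auto simp: graph_auts_def verts)
  ultimately have "\<Phi> \<in> iso (perm_symmetry_group n m c p) (graph_aut_group (hamiltonian_graph n m c p))"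
    using \<Phi> mult
    by (auto simp: iso_def hom_def bij_betw_def perm_symmetry_group_def graph_aut_group_def
        sym_group_mult BijGroup_def verts subset_iff)
  then show ?thesis by (rule is_isoI)
qed

end
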